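(* Let $\Lambda\subset\mathbb{R}^2$ be a $2$-dimensional integral lattice. Then $\Lambda$ is universally concyclic; that is, for every integer $n>0$ there is a circle in the plane $\mathbb{R}^2$ that passes through exactly $n$ points of $\Lambda$.
   Context: A $2$-dimensional lattice in $\mathbb{R}^2$ is a set $\Lambda=\mathbb{Z}u+\mathbb{Z}v$ with $u,v\in\mathbb{R}^2$ linearly independent over $\mathbb{R}$. It is called integral if $(x,y)\in\mathbb{Z}$ for all $x,y\in\Lambda$, where $(x,y)$ is the standard inner product on $\mathbb{R}^2$. A lattice $\Lambda\subset\mathbb{R}^2$ is called universally concyclic if for every integer $n>0$ there is a circle in $\mathbb{R}^2$ (with arbitrary center and positive radius) that passes through exactly $n$ points of $\Lambda$. *)

theory Defs
  imports "HOL-Analysis.Analysis"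
begin

text \<open>The condition \<open>u \<noteq> v\<close> is needed because \<open>independent {u, v}\<close> speaks about the set
  \<open>{u, v}\<close>, which collapses to a singleton when \<open>u = v\<close>.\<close>

definition plane_lattice :: "(real ^ 2) set \<Rightarrow> bool" where
  "plane_lattice L \<longleftrightarrow>
     (\<exists>u v. u \<noteq> v \<and> independent {u, v} \<and>
        L = {of_int a *\<^sub>R u + of_int b *\<^sub>R v | a b :: int. True})"

definition integral_lattice :: "(real ^ 2) set \<Rightarrow> bool" where
  "integral_lattice L \<longleftrightarrow> plane_lattice L \<and> (\<forall>x\<in>L. \<forall>y\<in>L. x \<bullet> y \<in> \<int>)"

text \<open>As \<open>n > 0\<close>, the equation \<open>card (L \<inter> sphere c r) = n\<close> also forces the intersection to be
  finite.\<close>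

definition universally_concyclic :: "(real ^ 2) set \<Rightarrow> bool" where
  "universally_concyclic L \<longleftrightarrow>
     (\<forall>n::nat. n > 0 \<longrightarrow> (\<exists>c r. r > 0 \<and> card (L \<inter> sphere c r) = n))"

end

theory Submission
  imports Defs
begin

text \<open>Identify the plane with \<open>\<complex>\<close> and divide by the first basis vector. With the Gram matrix
\<open>a, b, c\<close> of the basis and \<open>D = a c - b\<^sup>2 > 0\<close>, the lattice becomes \<open>\<Lambda> = \<int> + \<int>\<tau>\<close> where
\<open>a \<tau> = b + \<omega>\<close> and \<open>\<omega>\<close> is a purely imaginary number with \<open>\<omega>\<^sup>2 = - D\<close>. Integrality of the lattice is
what makes \<open>\<Lambda>\<close> a module over the quadratic order \<open>\<O> = \<int> + \<int>\<omega>\<close>; moreover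
\<open>\<O> \<subseteq> \<Lambda>\<close> and \<open>a \<Lambda> \<subseteq> \<O>\<close>. A circle whose centre is a rational point of \<open>\<Lambda>\<close> corresponds,
after scaling by an integer \<open>M\<close>, to the points of a coset \<open>z\<^sub>0 + M \<Lambda>\<close> that have a given absolute
value, so the task is to find cosets in which some absolute value is taken exactly \<open>n\<close> times.

Fix a prime \<open>q\<close>, coprime to \<open>6 a D\<close>, modulo which \<open>- D\<close> is a square, and look only at absolute values
\<open>q\<^sup>m\<close>. Dividing by \<open>q\<^sup>m\<close> leads to the group of all \<open>u\<close> on the unit circle that become congruent to
\<open>1\<close> modulo \<open>M \<Lambda>\<close> once powers of \<open>q\<close> in the denominator are allowed (\<open>cong_units\<close>, for \<open>M\<close> divisible by
\<open>3 a\<close> and coprime to \<open>q\<close>). The factor \<open>3\<close> removes torsion. The group behaves like \<open>\<int>\<close>: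

\<^item> It is nontrivial (\<open>cong_units_nontrivial\<close>). This is the finiteness of the class group in
  disguise: by Thue's lemma there are elements of \<open>\<O>\<close> of norm \<open>c q\<^sup>2\<^sup>j\<close> with \<open>0 < c \<le> D + 1\<close>
  for every \<open>j\<close>, so two of them agree in \<open>c\<close> and in all relevant residues, and their quotient,
  scaled by a power of \<open>q\<close>, is a nontrivial element.

\<^item> It is generated by an element \<open>\<theta>\<close> whose denominator \<open>q\<^sup>h\<close> is as small as possible, and
  \<open>\<theta>\<^sup>i\<close> has denominator dividing \<open>q\<^sup>m\<close> iff \<open>\<bar>i\<bar> h \<le> m\<close> (\<open>cong_units_generator\<close> and \<open>powi_integral\<close>). The
  reason is that only the two primes above \<open>q\<close> can occur in the denominator of \<open>u\<close>, and they occur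
  with opposite exponents; multiplying by \<open>\<theta>\<close> or by its conjugate then cancels \<open>q\<^sup>h\<close>. In
  elementary terms this is \<open>primitive_prime_power_norms_divide\<close>.

Take \<open>\<theta>\<close> for \<open>3 a\<close> and then a multiple \<open>M\<close> of \<open>3 a\<close> for which \<open>\<theta>\<close> is not in the group; the group
for \<open>M\<close> consists of the powers of \<open>\<theta>\<^sup>t\<close> for some \<open>t \<ge> 2\<close>. The points of absolute value \<open>q\<^sup>m\<close> in the
coset of \<open>q\<^sup>m \<theta>\<^sup>c\<close> modulo \<open>M \<Lambda>\<close> are therefore the numbers \<open>q\<^sup>m \<theta>\<^sup>c\<^sup>+\<^sup>t\<^sup>i\<close> with
\<open>\<bar>c + t i\<bar> h \<le> m\<close>. With \<open>c = 0\<close> the admitted \<open>i\<close> form a symmetric interval, which gives every odd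
\<open>n\<close>; with \<open>c = 1\<close> and \<open>m = (t k - 1) h\<close> they are \<open>- k, \<dots>, k - 1\<close>, which gives every even
\<open>n = 2 k\<close>.\<close>

section \<open>Elements of small norm\<close>

text \<open>Hensel lifting: a root modulo \<open>q\<^sup>n\<close> is corrected by a multiple of \<open>q\<^sup>n\<close>, found by inverting
the derivative \<open>2 s\<close> modulo \<open>q\<close>.\<close>

lemma sqrt_mod_prime_power:
  fixes q D :: int
  assumes "prime q" "\<not> q dvd 2" "\<not> q dvd D" "q dvd r\<^sup>2 + D"
  shows "\<exists>s. q ^ Suc n dvd s\<^sup>2 + D"
proof (induction n)
  case 0
  then show ?case using assms(4) by auto
next
  case (Suc n)
  then obtain s e where e: "s\<^sup>2 + D = q ^ Suc n * e" by (auto elim: dvdE)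
  have "\<not> q dvd s"
  proof
    assume "q dvd s"
    then have "q dvd q ^ Suc n * e - s\<^sup>2" by (simp add: power2_eq_square)
    with e assms(3) show False by (metis add_diff_cancel_left')
  qed
  then have "coprime q (2 * s)"
    using assms(1,2) by (meson prime_dvd_mult_iff prime_imp_coprime)
  then obtain u v where uv: "u * (2 * s) + v * q = 1"
    by (metis bezout_int coprime_iff_gcd_eq_1 gcd.commute)
  have "(s - q ^ Suc n * (u * e))\<^sup>2 + D
      = (s\<^sup>2 + D) - q ^ Suc n * (e * (u * (2 * s))) + q ^ Suc n * q ^ Suc n * (u * e)\<^sup>2"
    by (simp only: power2_eq_square) (simp only: algebra_simps mult_2)
  also have "\<dots> = q ^ Suc n * (e * (1 - u * (2 * s))) + q ^ Suc n * q ^ Suc n * (u * e)\<^sup>2"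
    by (simp only: e) (simp only: algebra_simps mult_1_right)
  also have "1 - u * (2 * s) = v * q" using uv by linarith
  also have "q ^ Suc n * (e * (v * q)) + q ^ Suc n * q ^ Suc n * (u * e)\<^sup>2
      = q ^ Suc (Suc n) * (e * v + q ^ n * (u * e)\<^sup>2)"
    by (simp add: algebra_simps)
  finally show ?case by (metis dvd_triv_left)
qed

text \<open>Among the \<open>(k + 1)\<^sup>2\<close> pairs of numbers in \<open>{0..k}\<close> two have the same \<open>x - s y\<close> modulo \<open>k\<^sup>2\<close>.\<close>

lemma thue:
  fixes k s :: int
  assumes "k > 0"
  shows "\<exists>x y. (x \<noteq> 0 \<or> y \<noteq> 0) \<and> \<bar>x\<bar> \<le> k \<and> \<bar>y\<bar> \<le> k \<and> k\<^sup>2 dvd x - s * y"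
proof -
  define f where "f = (\<lambda>(x, y). (x - s * y) mod k\<^sup>2)"
  have k2: "k\<^sup>2 > 0" using assms by simp
  have "f ` ({0..k} \<times> {0..k}) \<subseteq> {0..<k\<^sup>2}"
    using k2 by (auto simp: f_def)
  then have "card (f ` ({0..k} \<times> {0..k})) \<le> nat (k\<^sup>2)"
    by (metis card_atLeastLessThan_int card_mono diff_zero finite_atLeastLessThan_int)
  also have "nat (k\<^sup>2) < nat ((k + 1) * (k + 1))"
  proof (subst nat_less_eq_zless)
    have "k\<^sup>2 < (k + 1)\<^sup>2" using assms by (intro power_strict_mono) auto
    then show "k\<^sup>2 < (k + 1) * (k + 1)" by (simp add: power2_eq_square)
  qed (use k2 in simp)
  also have "\<dots> = card ({0..k} \<times> {0..k})"
    using assms by (simp add: card_cartesian_product nat_mult_distrib)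
  finally have "\<not> inj_on f ({0..k} \<times> {0..k})" by (rule pigeonhole)
  then obtain x y x' y' where *: "x \<in> {0..k}" "y \<in> {0..k}" "x' \<in> {0..k}" "y' \<in> {0..k}"
      "(x, y) \<noteq> (x', y')" "f (x, y) = f (x', y')"
    by (auto simp: inj_on_def)
  have "k\<^sup>2 dvd (x - x') - s * (y - y')"
    using *(6) by (simp add: f_def mod_eq_dvd_iff algebra_simps)
  then show ?thesis using * by (intro exI[of _ "x - x'"] exI[of _ "y - y'"]) auto
qed

text \<open>Thue's lemma for a square root \<open>s\<close> of \<open>- D\<close> modulo \<open>q\<^sup>2\<^sup>j\<close>: then \<open>x \<equiv> s y\<close> makes
\<open>x\<^sup>2 + D y\<^sup>2\<close> divisible by \<open>q\<^sup>2\<^sup>j\<close>, while \<open>\<bar>x\<bar>, \<bar>y\<bar> \<le> q\<^sup>j\<close> bounds the quotient \<open>c\<close>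
independently of \<open>j\<close>. The congruence says that one of the two prime ideals above \<open>q\<close>
divides \<open>x + y\<omega>\<close> to the order \<open>2 j\<close>. It is recorded beside the norm because division of \<open>x\<close> and
\<open>y\<close> by \<open>q\<^sup>d\<close> costs it only \<open>d\<close> factors \<open>q\<close>, whereas the norm loses \<open>2 d\<close> of them.\<close>

lemma small_norm_divisible:
  fixes q D :: int
  assumes "prime q" "\<not> q dvd 2" "\<not> q dvd D" "q dvd r\<^sup>2 + D" "D > 0"
  obtains s x y c where "q ^ (2 * j) dvd s\<^sup>2 + D" "q ^ (2 * j) dvd x - s * y"
    "x\<^sup>2 + D * y\<^sup>2 = c * q ^ (2 * j)" "0 < c" "c \<le> D + 1"
proof -
  obtain s where "q ^ Suc (2 * j) dvd s\<^sup>2 + D" using sqrt_mod_prime_power assms by blast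
  then have s: "q ^ (2 * j) dvd s\<^sup>2 + D" by (metis dvd_mult_right power_Suc)
  have q0: "q > 0" using assms(1) by (simp add: prime_gt_0_int)
  obtain x y where xy: "x \<noteq> 0 \<or> y \<noteq> 0" "\<bar>x\<bar> \<le> q ^ j" "\<bar>y\<bar> \<le> q ^ j" "(q ^ j)\<^sup>2 dvd x - s * y"
    using thue[of "q ^ j" s] q0 by auto
  have sq: "(q ^ j)\<^sup>2 = q ^ (2 * j)" by (simp add: power_mult[symmetric] mult.commute)
  have "x\<^sup>2 + D * y\<^sup>2 = (x - s * y) * (x + s * y) + y\<^sup>2 * (s\<^sup>2 + D)"
    by (simp add: power2_eq_square algebra_simps)
  then have "q ^ (2 * j) dvd x\<^sup>2 + D * y\<^sup>2" using s xy(4) sq by auto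
  then obtain c where c: "x\<^sup>2 + D * y\<^sup>2 = c * q ^ (2 * j)" by (metis dvdE mult.commute)
  have "x\<^sup>2 + D * y\<^sup>2 > 0" using xy(1) assms(5)
    by (metis add_nonneg_pos add_pos_nonneg less_imp_le mult_nonneg_nonneg mult_pos_pos zero_le_power2 zero_less_power2)
  then have "c > 0" using c q0 by (metis zero_less_mult_pos2 zero_less_power)
  have "x\<^sup>2 \<le> (q ^ j)\<^sup>2" "y\<^sup>2 \<le> (q ^ j)\<^sup>2" using xy(2,3) q0
    by (simp_all add: abs_le_square_iff[symmetric])
  then have "x\<^sup>2 + D * y\<^sup>2 \<le> (q ^ j)\<^sup>2 + D * (q ^ j)\<^sup>2"
    using assms(5) by (intro add_mono mult_left_mono) auto
  then have "c * q ^ (2 * j) \<le> (D + 1) * q ^ (2 * j)" using c sq by (simp add: algebra_simps)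
  then have "c \<le> D + 1" using q0 by simp
  then show ?thesis using that s xy(4) c \<open>c > 0\<close> sq by auto
qed

text \<open>Let \<open>z = x + y\<omega>\<close> and \<open>w = a + b\<omega>\<close> be indivisible by \<open>q\<close>, with norms powers of \<open>q\<close>. Only one of
the two prime ideals above \<open>q\<close> divides \<open>z\<close>, and likewise for \<open>w\<close>; if they are different, \<open>z w\<close> is
divisible by the full norm of \<open>w\<close>, otherwise \<open>z\<close> times the conjugate of \<open>w\<close> is. The disjunction lists
the coordinates of these two products. The proof avoids ideals: the product of the two
\<open>\<omega>\<close>-coordinates is divisible by \<open>q\<^sup>2\<^sup>h\<close>, and \<open>q\<close> cannot divide both of them.\<close>

lemma primitive_prime_power_norms_divide:
  fixes q D x y a b :: int
  assumes q: "prime q" "\<not> q dvd 2" "\<not> q dvd D" and hl: "0 < h" "h \<le> l"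
    and xy: "x\<^sup>2 + D * y\<^sup>2 = q ^ (2 * l)" "\<not> (q dvd x \<and> q dvd y)"
    and ab: "a\<^sup>2 + D * b\<^sup>2 = q ^ (2 * h)" "\<not> (q dvd a \<and> q dvd b)"
  shows "q ^ (2 * h) dvd x * a - D * y * b \<and> q ^ (2 * h) dvd y * a + x * b \<or>
         q ^ (2 * h) dvd x * a + D * y * b \<and> q ^ (2 * h) dvd y * a - x * b"
proof -
  have qd: "q dvd q ^ (2 * h)" "q dvd q ^ (2 * l)" using hl by (auto intro: dvd_power)
  have "\<not> q dvd y"
  proof
    assume y: "q dvd y"
    then have "q dvd q ^ (2 * l) - D * y\<^sup>2" using qd(2) by (auto simp: power2_eq_square)
    then have "q dvd x\<^sup>2" using xy(1) by (metis add_diff_cancel_right')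
    then show False using y xy(2) q(1) prime_dvd_power by blast
  qed
  moreover have "\<not> q dvd a"
  proof
    assume a: "q dvd a"
    then have "q dvd q ^ (2 * h) - a\<^sup>2" using qd(1) by (auto simp: power2_eq_square)
    then have "q dvd D * b\<^sup>2" using ab(1) by (metis add_diff_cancel_left')
    then show False using a ab(2) q prime_dvd_power prime_dvd_mult_iff by blast
  qed
  ultimately have nd: "\<not> q dvd 2 * (y * a)" using q by (simp add: prime_dvd_mult_iff)
  have le: "q ^ (2 * h) dvd q ^ (2 * l)" using hl by (intro le_imp_power_dvd) auto
  have "(y * a + x * b) * (y * a - x * b)
      = y\<^sup>2 * (a\<^sup>2 + D * b\<^sup>2) - b\<^sup>2 * (x\<^sup>2 + D * y\<^sup>2)"
    by (simp add: power2_eq_square algebra_simps)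
  then have dv: "q ^ (2 * h) dvd (y * a + x * b) * (y * a - x * b)"
    using xy(1) ab(1) le by auto
  \<comment> \<open>The norm of a product transfers divisibility from the \<open>\<omega>\<close>-coordinate to the real one.\<close>
  have real_part: "q ^ (2 * h) dvd X" if X: "X\<^sup>2 + D * Y\<^sup>2 = q ^ (2 * l) * q ^ (2 * h)"
    and Y: "q ^ (2 * h) dvd Y" for X Y
  proof -
    have "(q ^ (2 * h))\<^sup>2 dvd q ^ (2 * l) * q ^ (2 * h)"
      using le by (simp add: power2_eq_square mult_dvd_mono)
    moreover have "(q ^ (2 * h))\<^sup>2 dvd D * Y\<^sup>2" using Y by auto
    ultimately have "(q ^ (2 * h))\<^sup>2 dvd X\<^sup>2" using X by (metis dvd_add_left_iff)
    then show ?thesis by simp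
  qed
  have N1: "(x * a - D * y * b)\<^sup>2 + D * (y * a + x * b)\<^sup>2 = q ^ (2 * l) * q ^ (2 * h)"
    unfolding xy(1)[symmetric] ab(1)[symmetric] by (simp add: power2_eq_square algebra_simps)
  have N2: "(x * a + D * y * b)\<^sup>2 + D * (y * a - x * b)\<^sup>2 = q ^ (2 * l) * q ^ (2 * h)"
    unfolding xy(1)[symmetric] ab(1)[symmetric] by (simp add: power2_eq_square algebra_simps)
  show ?thesis
  proof (cases "q dvd y * a + x * b")
    case True
    have "\<not> q dvd y * a - x * b"
    proof
      assume "q dvd y * a - x * b"
      with True have "q dvd (y * a + x * b) + (y * a - x * b)" by (rule dvd_add)
      with nd show False by (simp add: algebra_simps)
    qed
    then have "coprime (q ^ (2 * h)) (y * a - x * b)"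
      using q(1) prime_imp_coprime by (metis coprime_power_left_iff)
    then have "q ^ (2 * h) dvd y * a + x * b" using dv by (simp add: coprime_dvd_mult_left_iff)
    then show ?thesis using real_part N1 by blast
  next
    case False
    then have "coprime (q ^ (2 * h)) (y * a + x * b)"
      using q(1) prime_imp_coprime by (metis coprime_power_left_iff)
    then have "q ^ (2 * h) dvd y * a - x * b" using dv by (simp add: coprime_dvd_mult_right_iff)
    then show ?thesis using real_part N2 by blast
  qed
qed

section \<open>The lattice as a module over a quadratic order\<close>

text \<open>The complex model of an integral lattice: \<open>\<int> + \<int>\<tau>\<close> is similar to the lattice with Gram matrix
entries \<open>a\<close>, \<open>b\<close> and \<open>c = (b\<^sup>2 + D) / a\<close>. The sign of \<open>\<omega>\<close> is left open, so that both orientations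
of a basis are covered.\<close>

locale quad_lattice =
  fixes D a b :: int and \<omega> \<tau> :: complex
  assumes D_pos: "D > 0" and a_pos: "a > 0"
    and omega_sq: "\<omega> * \<omega> = - of_int D" and omega_cnj: "cnj \<omega> = - \<omega>"
    and tau: "of_int a * \<tau> = of_int b + \<omega>"
    and a_dvd: "a dvd b\<^sup>2 + D"
begin

definition pt :: "int \<Rightarrow> int \<Rightarrow> complex" where
  "pt x y = of_int x + of_int y * \<omega>"

definition \<O> :: "complex set" where
  "\<O> = {pt x y | x y. True}"

definition lat :: "complex set" where
  "lat = {of_int x + of_int y * \<tau> | x y :: int. True}"

definition mlat :: "int \<Rightarrow> complex set" where
  "mlat M = {of_int M * l | l. l \<in> lat}"

lemma pt_add: "pt x y + pt x' y' = pt (x + x') (y + y')"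
  by (simp add: pt_def algebra_simps)

lemma pt_uminus: "- pt x y = pt (- x) (- y)"
  by (simp add: pt_def)

lemma pt_scale: "of_int k * pt x y = pt (k * x) (k * y)"
  by (simp add: pt_def algebra_simps)

lemma pt_mult: "pt x y * pt x' y' = pt (x * x' - D * y * y') (y * x' + x * y')"
proof -
  have "pt x y * pt x' y' = of_int (x * x') + of_int (y * y') * (\<omega> * \<omega>) + of_int (y * x' + x * y') * \<omega>"
    by (simp add: pt_def algebra_simps)
  then show ?thesis by (simp add: omega_sq pt_def algebra_simps)
qed

lemma pt_cnj: "cnj (pt x y) = pt x (- y)"
  by (simp add: pt_def omega_cnj)

lemma pt_norm: "(cmod (pt x y))\<^sup>2 = of_int (x\<^sup>2 + D * y\<^sup>2)"
proof -
  have "complex_of_real ((cmod (pt x y))\<^sup>2) = complex_of_real (of_int (x\<^sup>2 + D * y\<^sup>2))"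
    unfolding complex_norm_square pt_cnj pt_mult by (simp add: pt_def power2_eq_square algebra_simps)
  then show ?thesis using of_real_eq_iff by blast
qed

lemma pt_eq_0: "pt x y = 0 \<longleftrightarrow> x = 0 \<and> y = 0"
proof
  assume "pt x y = 0"
  then have "real_of_int (x\<^sup>2 + D * y\<^sup>2) = 0" using pt_norm[of x y] by simp
  then have "x\<^sup>2 + D * y\<^sup>2 = 0" using of_int_eq_0_iff by blast
  then show "x = 0 \<and> y = 0" using D_pos
    by (metis add_nonneg_eq_0_iff less_imp_le mult_nonneg_nonneg zero_le_power2 mult_eq_0_iff less_irrefl zero_eq_power2)
qed (simp add: pt_def)

lemma pt_eq_iff: "pt x y = pt x' y' \<longleftrightarrow> x = x' \<and> y = y'"
proof -
  have "pt x y = pt (x - x') (y - y') + pt x' y'" by (simp add: pt_add)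
  then show ?thesis using pt_eq_0[of "x - x'" "y - y'"] by auto
qed

lemma pt_0: "pt x 0 = of_int x" by (simp add: pt_def)

lemma pt_in_O [simp]: "pt x y \<in> \<O>" by (auto simp: \<O>_def)

lemma O_cases: "z \<in> \<O> \<Longrightarrow> (\<And>x y. z = pt x y \<Longrightarrow> P) \<Longrightarrow> P" by (auto simp: \<O>_def)

lemma of_int_in_O [simp]: "of_int k \<in> \<O>" by (metis pt_0 pt_in_O)

lemma O_add: "z \<in> \<O> \<Longrightarrow> w \<in> \<O> \<Longrightarrow> z + w \<in> \<O>"
  by (auto elim!: O_cases simp: pt_add)

lemma O_mult: "z \<in> \<O> \<Longrightarrow> w \<in> \<O> \<Longrightarrow> z * w \<in> \<O>"
  by (auto elim!: O_cases simp: pt_mult)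

lemma O_uminus: "z \<in> \<O> \<Longrightarrow> - z \<in> \<O>"
  by (auto elim!: O_cases simp: pt_uminus)

lemma O_diff: "z \<in> \<O> \<Longrightarrow> w \<in> \<O> \<Longrightarrow> z - w \<in> \<O>"
  using O_add[OF _ O_uminus] by fastforce

lemma O_cnj: "z \<in> \<O> \<Longrightarrow> cnj z \<in> \<O>"
  by (auto elim!: O_cases simp: pt_cnj)

lemma O_power: "z \<in> \<O> \<Longrightarrow> z ^ n \<in> \<O>"
  by (induction n) (use of_int_in_O[of 1] in \<open>auto intro: O_mult\<close>)

lemma lat_add: "z \<in> lat \<Longrightarrow> w \<in> lat \<Longrightarrow> z + w \<in> lat"
proof -
  have "(of_int x + of_int y * \<tau>) + (of_int x' + of_int y' * \<tau>) = of_int (x + x') + of_int (y + y') * \<tau>" for x y x' y'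
    by (simp add: algebra_simps)
  then show "z \<in> lat \<Longrightarrow> w \<in> lat \<Longrightarrow> z + w \<in> lat" unfolding lat_def by blast
qed

text \<open>Multiplication by \<open>\<omega>\<close> preserves the lattice since \<open>\<omega> \<cdot> 1 = a \<tau> - b\<close> and \<open>\<omega> \<tau> = b \<tau> - c\<close>
with \<open>c = (b\<^sup>2 + D) / a\<close>; this is where integrality of all three Gram entries enters.\<close>

lemma O_mult_lat: "z \<in> \<O> \<Longrightarrow> w \<in> lat \<Longrightarrow> z * w \<in> lat"
proof -
  assume "z \<in> \<O>" "w \<in> lat"
  then obtain x y m n where z: "z = pt x y" and w: "w = of_int m + of_int n * \<tau>"
    by (auto simp: \<O>_def lat_def)
  obtain c where c: "b\<^sup>2 + D = a * c" using a_dvd by blast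
  have om: "\<omega> = of_int a * \<tau> - of_int b" using tau by simp
  have "of_int a * (\<omega> * \<tau>) = \<omega> * (of_int b + \<omega>)" by (simp add: tau[symmetric])
  also have "\<dots> = of_int b * \<omega> - of_int D" by (simp add: algebra_simps omega_sq)
  also have "\<dots> = of_int a * (of_int b * \<tau>) - of_int (b\<^sup>2 + D)" by (simp add: om power2_eq_square algebra_simps)
  also have "\<dots> = of_int a * (of_int b * \<tau> - of_int c)" by (simp only: c of_int_mult right_diff_distrib)
  finally have ot: "\<omega> * \<tau> = of_int b * \<tau> - of_int c" using a_pos by simp
  have "z * w = of_int (x * m) + of_int (x * n) * \<tau> + of_int (y * m) * \<omega> + of_int (y * n) * (\<omega> * \<tau>)"
    by (simp add: z w pt_def algebra_simps)
  also have "\<dots> = of_int (x * m - y * m * b - y * n * c) + of_int (x * n + y * m * a + y * n * b) * \<tau>"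
    unfolding ot by (simp add: om algebra_simps)
  finally show ?thesis unfolding lat_def by blast
qed

lemma O_subset_lat: "z \<in> \<O> \<Longrightarrow> z \<in> lat"
proof -
  have "1 = of_int 1 + of_int 0 * \<tau>" by simp
  then have "1 \<in> lat" unfolding lat_def by blast
  then show "z \<in> \<O> \<Longrightarrow> z \<in> lat" using O_mult_lat[of z 1] by simp
qed

lemma a_lat: "w \<in> lat \<Longrightarrow> of_int a * w \<in> \<O>"
proof -
  assume "w \<in> lat"
  then obtain m n where w: "w = of_int m + of_int n * \<tau>" by (auto simp: lat_def)
  have "of_int a * w = of_int (a * m) + of_int n * (of_int a * \<tau>)" by (simp add: w algebra_simps)
  also have "\<dots> = pt (a * m + n * b) n" unfolding tau by (simp add: pt_def algebra_simps)
  finally show ?thesis by simp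
qed

lemma mlat_add: "z \<in> mlat M \<Longrightarrow> w \<in> mlat M \<Longrightarrow> z + w \<in> mlat M"
  unfolding mlat_def using lat_add by (auto simp: distrib_left[symmetric])

lemma O_mult_mlat: "z \<in> \<O> \<Longrightarrow> w \<in> mlat M \<Longrightarrow> z * w \<in> mlat M"
  unfolding mlat_def using O_mult_lat by (auto simp: mult.left_commute)

lemma mlat_uminus: "w \<in> mlat M \<Longrightarrow> - w \<in> mlat M"
  using O_mult_mlat[of "of_int (-1)" w M] of_int_in_O[of "-1"] by simp

lemma M_mult_O: "z \<in> \<O> \<Longrightarrow> of_int M * z \<in> mlat M"
  unfolding mlat_def using O_subset_lat by blast

lemma mlat_dvd:
  assumes "k * a dvd M" "w \<in> mlat M"
  shows "\<exists>x y. w = pt (k * x) (k * y)"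
proof -
  obtain c where c: "M = k * a * c" using assms(1) by (auto elim: dvdE)
  obtain l where l: "w = of_int M * l" "l \<in> lat" using assms(2) by (auto simp: mlat_def)
  have "of_int c * (of_int a * l) \<in> \<O>" using l a_lat O_mult by simp
  then obtain x y where "of_int c * (of_int a * l) = pt x y" by (auto simp: \<O>_def)
  then have "w = of_int k * pt x y" by (simp add: c l algebra_simps)
  then show ?thesis by (auto simp: pt_scale)
qed

lemma mlat_mono: "M dvd M' \<Longrightarrow> w \<in> mlat M' \<Longrightarrow> w \<in> mlat M"
proof -
  assume "M dvd M'" "w \<in> mlat M'"
  moreover from this(1) obtain c where "M' = M * c" by (auto elim: dvdE)
  moreover from calculation(2) obtain l where "w = of_int M' * l" "l \<in> lat" by (auto simp: mlat_def)
  ultimately have "w = of_int M * (of_int c * l)" "of_int c * l \<in> lat" using O_mult_lat by auto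
  then show ?thesis by (auto simp: mlat_def)
qed

end

section \<open>Units of absolute value one, up to powers of a split prime\<close>

text \<open>The prime \<open>q\<close> is chosen unramified, split and prime to the index of \<open>\<O>\<close> in the lattice. That it
differs from \<open>3\<close> leaves congruences modulo \<open>3\<close> meaningful after \<open>q\<close> is inverted.\<close>

locale quad_lattice_prime = quad_lattice +
  fixes q :: int
  assumes q_prime: "prime q" and q_odd: "\<not> q dvd 2" and q_D: "\<not> q dvd D" and q_a: "\<not> q dvd 3 * a"
    and q_split: "\<exists>r. q dvd r\<^sup>2 + D"
begin

lemma q_pos: "q > 0" using q_prime by (simp add: prime_gt_0_int)

lemma q_ne_0 [simp]: "q \<noteq> 0" using q_pos by simp

text \<open>The elements \<open>u\<close> of norm one with \<open>u \<equiv> 1\<close> modulo \<open>M \<Lambda>[1/q]\<close>; the exponent \<open>n\<close> clears the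
denominator.\<close>

definition cong_units :: "int \<Rightarrow> complex set" where
  "cong_units M = {u. cmod u = 1 \<and> (\<exists>n. of_int q ^ n * (u - 1) \<in> mlat M)}"

definition admissible :: "int \<Rightarrow> bool" where
  "admissible M \<longleftrightarrow> M > 0 \<and> coprime M q \<and> 3 * a dvd M"

text \<open>Congruence to \<open>1\<close> modulo \<open>M \<Lambda>\<close> keeps everything inside \<open>\<O>[1/q]\<close>, because \<open>a\<close> divides \<open>M\<close>.\<close>

lemma mlat_subset_O: "admissible M \<Longrightarrow> w \<in> mlat M \<Longrightarrow> w \<in> \<O>"
  using mlat_dvd[of 3 M w] by (auto simp: admissible_def)

lemma q_power_O [simp]: "of_int q ^ n \<in> \<O>"
  by (simp add: O_power)

lemma cong_units_integral:
  assumes "admissible M" "u \<in> cong_units M"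
  obtains n where "of_int q ^ n * u \<in> \<O>" "of_int q ^ n * (u - 1) \<in> mlat M"
proof -
  obtain n where n: "of_int q ^ n * (u - 1) \<in> mlat M" using assms by (auto simp: cong_units_def)
  have "of_int q ^ n * u = of_int q ^ n * (u - 1) + of_int q ^ n" by (simp add: algebra_simps)
  then have "of_int q ^ n * u \<in> \<O>" using n assms(1) by (simp add: O_add mlat_subset_O)
  then show ?thesis using n that by blast
qed

lemma cong_units_mult:
  assumes "admissible M" "u \<in> cong_units M" "v \<in> cong_units M"
  shows "u * v \<in> cong_units M"
proof -
  obtain n where n: "of_int q ^ n * u \<in> \<O>" "of_int q ^ n * (u - 1) \<in> mlat M"
    using cong_units_integral assms by blast
  obtain m where m: "of_int q ^ m * (v - 1) \<in> mlat M"
    using cong_units_integral assms by blast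
  have "of_int q ^ (n + m) * (u * v - 1)
      = of_int q ^ n * u * (of_int q ^ m * (v - 1)) + of_int q ^ m * (of_int q ^ n * (u - 1))"
    by (simp add: algebra_simps power_add)
  then have "of_int q ^ (n + m) * (u * v - 1) \<in> mlat M" using n m
    by (simp add: mlat_add O_mult_mlat)
  then show ?thesis using assms by (auto simp: cong_units_def norm_mult)
qed

lemma cnj_unit: "cmod u = 1 \<Longrightarrow> u * cnj u = 1"
  using complex_norm_square[of u] by simp

lemma cong_units_cnj:
  assumes "admissible M" "u \<in> cong_units M"
  shows "cnj u \<in> cong_units M"
proof -
  obtain n where n: "of_int q ^ n * u \<in> \<O>" "of_int q ^ n * (u - 1) \<in> mlat M"
    using cong_units_integral assms by blast
  have c: "cnj (of_int q ^ n * u) \<in> \<O>" using n O_cnj by blast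
  have "cmod u = 1" using assms by (auto simp: cong_units_def)
  then have 1: "u * cnj u = 1" by (rule cnj_unit)
  have "cnj (of_int q ^ n * u) * (- (of_int q ^ n * (u - 1))) = of_int q ^ n * (of_int q ^ n * (cnj u - u * cnj u))"
    by (simp add: algebra_simps)
  also have "\<dots> = of_int q ^ (n + n) * (cnj u - 1)" unfolding 1 by (simp add: power_add)
  finally have "of_int q ^ (n + n) * (cnj u - 1) \<in> mlat M"
    using c n by (metis O_mult_mlat mlat_uminus)
  then show ?thesis using \<open>cmod u = 1\<close> by (auto simp: cong_units_def)
qed

lemma one_in_cong_units: "1 \<in> cong_units M"
  using M_mult_O[of "of_int 0" M] of_int_in_O[of 0] by (simp add: cong_units_def)

lemma cong_units_norm: "u \<in> cong_units M \<Longrightarrow> cmod u = 1" by (simp add: cong_units_def)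

lemma inverse_cong_units: "u \<in> cong_units M \<Longrightarrow> inverse u = cnj u"
  using cong_units_norm cnj_unit inverse_unique by blast

lemma cong_units_powi:
  assumes "admissible M" "u \<in> cong_units M"
  shows "u powi i \<in> cong_units M"
proof -
  have *: "v ^ n \<in> cong_units M" if "v \<in> cong_units M" for v n
    using that by (induction n) (auto intro: cong_units_mult one_in_cong_units assms)
  show ?thesis using assms *[of u] *[of "cnj u"]
    by (auto simp: power_int_def inverse_cong_units cong_units_cnj)
qed

lemma cong_units_mono: "M dvd M' \<Longrightarrow> u \<in> cong_units M' \<Longrightarrow> u \<in> cong_units M"
  using mlat_mono by (auto simp: cong_units_def)

text \<open>Since \<open>M\<close> is invertible modulo powers of \<open>q\<close>, inverting \<open>q\<close> adds no element of \<open>\<O>\<close> to \<open>M \<Lambda>\<close>.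
This turns statements about \<open>M \<Lambda>[1/q]\<close> back into statements about the lattice.\<close>

lemma mlat_cancel_q:
  assumes "admissible M" "z \<in> \<O>" "of_int q ^ n * z \<in> mlat M"
  shows "z \<in> mlat M"
proof -
  have "coprime M (q ^ n)" using assms(1) by (simp add: admissible_def)
  then obtain u v where uv: "u * M + v * q ^ n = 1"
    by (metis bezout_int coprime_iff_gcd_eq_1)
  have "z = of_int (u * M + v * q ^ n) * z" using uv by simp
  also have "\<dots> = of_int u * (of_int M * z) + of_int v * (of_int q ^ n * z)"
    by (simp add: algebra_simps)
  finally show ?thesis using assms M_mult_O
    by (metis mlat_add O_mult_mlat of_int_in_O)
qed

text \<open>A unit in \<open>\<O>\<close> congruent to \<open>1\<close> modulo \<open>3\<close> differs from \<open>1\<close> by a multiple of \<open>3\<close>, yet by at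
most \<open>2\<close> in absolute value. Hence every other element of the group has a genuine denominator.\<close>

lemma cong_units_integral_trivial:
  assumes M: "admissible M" and u: "u \<in> cong_units M" "u \<in> \<O>"
  shows "u = 1"
proof -
  obtain n where "of_int q ^ n * (u - 1) \<in> mlat M" using cong_units_integral M u by blast
  moreover have "u - 1 \<in> \<O>" using u O_diff of_int_in_O[of 1] by simp
  ultimately have "u - 1 \<in> mlat M" using mlat_cancel_q M by blast
  then obtain x y where xy: "u - 1 = pt (3 * x) (3 * y)"
    using mlat_dvd[of 3 M "u - 1"] M unfolding admissible_def by blast
  have "cmod (u - 1) \<le> 2" using norm_triangle_ineq4[of u 1] cong_units_norm[OF u(1)] by simp
  then have "(cmod (pt (3 * x) (3 * y)))\<^sup>2 \<le> 2\<^sup>2" unfolding xy by (intro power_mono) auto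
  then have "real_of_int ((3 * x)\<^sup>2 + D * (3 * y)\<^sup>2) \<le> 4" unfolding pt_norm by simp
  then have "(3 * x)\<^sup>2 + D * (3 * y)\<^sup>2 \<le> 4" by linarith
  moreover define N where "N = x\<^sup>2 + D * y\<^sup>2"
  moreover have "(3 * x)\<^sup>2 + D * (3 * y)\<^sup>2 = 9 * N"
    by (simp add: N_def power2_eq_square algebra_simps)
  moreover have "0 \<le> N" using D_pos by (simp add: N_def)
  ultimately have "x\<^sup>2 + D * y\<^sup>2 = 0" by linarith
  then have "x = 0 \<and> y = 0" using pt_norm[of x y] pt_eq_0 by simp
  then show ?thesis using xy by (simp add: pt_def)
qed

text \<open>The exponent \<open>n\<close> of the exact denominator \<open>q\<^sup>n\<close> of \<open>u\<close> plays the part of the absolute value of an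
integer in the cyclic group to come.\<close>

lemma primitive_multiple:
  assumes M: "admissible M" and u: "u \<in> cong_units M" "u \<noteq> 1"
  obtains n x y where "n > 0" "of_int q ^ n * u = pt x y" "\<not> (q dvd x \<and> q dvd y)"
    "x\<^sup>2 + D * y\<^sup>2 = q ^ (2 * n)" "\<And>m. of_int q ^ m * u \<in> \<O> \<Longrightarrow> n \<le> m"
proof -
  define n where "n = (LEAST m. of_int q ^ m * u \<in> \<O>)"
  obtain n0 where "of_int q ^ n0 * u \<in> \<O>" using cong_units_integral M u by blast
  then have n: "of_int q ^ n * u \<in> \<O>" unfolding n_def by (rule LeastI)
  have least: "n \<le> m" if "of_int q ^ m * u \<in> \<O>" for m
    unfolding n_def using that by (rule Least_le)
  have "n \<noteq> 0" using cong_units_integral_trivial[OF M u(1)] u(2) n by (cases n) auto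
  obtain x y where xy: "of_int q ^ n * u = pt x y" using n by (auto simp: \<O>_def)
  have prim: "\<not> (q dvd x \<and> q dvd y)"
  proof
    assume "q dvd x \<and> q dvd y"
    then obtain x' y' where "x = q * x'" "y = q * y'" by (auto elim!: dvdE)
    then have "of_int q * (of_int q ^ (n - 1) * u) = of_int q * pt x' y'"
      using xy \<open>n \<noteq> 0\<close> by (cases n) (auto simp: pt_scale mult.assoc)
    then have "of_int q ^ (n - 1) * u = pt x' y'" by simp
    then have "n \<le> n - 1" using least by simp
    then show False using \<open>n \<noteq> 0\<close> by simp
  qed
  have "real_of_int (x\<^sup>2 + D * y\<^sup>2) = (cmod (of_int q ^ n * u))\<^sup>2" unfolding xy pt_norm ..
  also have "\<dots> = of_int (q ^ (2 * n))" using cong_units_norm[OF u(1)] q_pos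
    by (simp add: norm_mult norm_power power_mult[symmetric] mult.commute)
  finally have "x\<^sup>2 + D * y\<^sup>2 = q ^ (2 * n)" using of_int_eq_iff by blast
  then show ?thesis using that xy prim least \<open>n \<noteq> 0\<close> by blast
qed

section \<open>A generator of the unit group\<close>

text \<open>Among the elements of norm \<open>c q\<^sup>2\<^sup>j\<close> with \<open>c \<le> D + 1\<close> there are two, \<open>z i\<close> and \<open>z k\<close>, with the
same \<open>c\<close>, congruent modulo \<open>c M\<close>. Their quotient times a power of \<open>q\<close> is
\<open>u = z k \<cdot> cnj (z i) / (c q\<^sup>\<dots>)\<close>, and the congruences put it into the group. If it were \<open>1\<close>, then
\<open>z k\<close> would be \<open>q\<^sup>d \<cdot> z i\<close>; the divisibility of \<open>z k\<close> would pass to \<open>z i\<close> and force \<open>q\<^sup>d\<close> to divide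
\<open>c\<close>, which is too small.\<close>

lemma cong_units_nontrivial:
  assumes M: "admissible M"
  obtains u where "u \<in> cong_units M" "u \<noteq> 1"
proof -
  have M_pos: "M > 0" using M by (simp add: admissible_def)
  \<comment> \<open>Only exponents that are multiples of \<open>g\<close> are used, so that \<open>q\<^sup>d\<close> exceeds every possible \<open>c\<close>.\<close>
  define g where "g = nat (D + 1)"
  have qg: "D + 1 < q ^ g"
  proof -
    have "int g < 2 ^ g" by (rule of_nat_less_two_power)
    also have "(2::int) ^ g \<le> q ^ g" using q_prime by (intro power_mono) (auto simp: prime_ge_2_int)
    finally show ?thesis using D_pos by (simp add: g_def)
  qed
  obtain r where r: "q dvd r\<^sup>2 + D" using q_split by blast
  have "\<forall>k. \<exists>s x y c. q ^ (2 * (g * k)) dvd s\<^sup>2 + D \<and> q ^ (2 * (g * k)) dvd x - s * y \<and>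
    x\<^sup>2 + D * y\<^sup>2 = c * q ^ (2 * (g * k)) \<and> 0 < c \<and> c \<le> D + 1"
    using small_norm_divisible[OF q_prime q_odd q_D r D_pos] by metis
  then obtain s x y c where *: "\<And>k. q ^ (2 * (g * k)) dvd (s k)\<^sup>2 + D"
      "\<And>k. q ^ (2 * (g * k)) dvd x k - s k * y k"
      "\<And>k. (x k)\<^sup>2 + D * (y k)\<^sup>2 = c k * q ^ (2 * (g * k))" "\<And>k. 0 < c k" "\<And>k. c k \<le> D + 1"
    by metis
  \<comment> \<open>The last component makes the two powers of \<open>q\<close> congruent modulo \<open>M\<close>.\<close>
  define key where "key = (\<lambda>k. (c k, x k mod (c k * M), y k mod (c k * M), q ^ (g * k) mod M))"
  have "range key \<subseteq> {0..D + 1} \<times> {0..(D + 1) * M} \<times> {0..(D + 1) * M} \<times> {0..M}"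
  proof
    fix w assume "w \<in> range key"
    then obtain k where w: "w = key k" by blast
    have "c k * M > 0" "c k * M \<le> (D + 1) * M" using *(4,5)[of k] M_pos by (auto intro: mult_right_mono)
    then have "0 \<le> z mod (c k * M) \<and> z mod (c k * M) \<le> (D + 1) * M" for z
      using pos_mod_bound[of "c k * M" z] pos_mod_sign[of "c k * M" z] by linarith
    moreover have "0 \<le> z mod M \<and> z mod M \<le> M" for z
      using M_pos pos_mod_bound[of M z] pos_mod_sign[of M z] by linarith
    ultimately show "w \<in> {0..D + 1} \<times> {0..(D + 1) * M} \<times> {0..(D + 1) * M} \<times> {0..M}"
      using *(4,5)[of k] by (auto simp: w key_def)
  qed
  then have "finite (range key)" by (rule finite_subset) simp
  then have "\<not> inj key" using finite_imageD infinite_UNIV_nat by blast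
  then obtain i k where ik: "i < k" "key i = key k"
    by (metis injI nat_neq_iff)
  define e where "e = c i"
  have e: "c i = e" "c k = e" "e > 0" "e \<le> D + 1" using ik(2) *(4,5)[of i] by (auto simp: key_def e_def)
  obtain p where p: "x k = x i + e * M * p"
    using ik(2) e by (auto simp: key_def) (metis mod_eqE)
  obtain p' where p': "y k = y i + e * M * p'"
    using ik(2) e by (auto simp: key_def) (metis mod_eqE)
  obtain w where w: "q ^ (g * k) = q ^ (g * i) + M * w"
    using ik(2) by (auto simp: key_def) (metis mod_eqE)
  define z where "z = (\<lambda>k. pt (x k) (y k))"
  have zk: "z k = z i + of_int (e * M) * pt p p'"
    by (simp only: z_def p p' pt_scale pt_add)
  have cmz: "(cmod (z l))\<^sup>2 = of_int (c l) * of_int q ^ (2 * (g * l))" for l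
    by (simp only: z_def pt_norm *(3) of_int_mult of_int_power)
  have zz: "z i * cnj (z i) = of_int e * of_int q ^ (2 * (g * i))"
    unfolding complex_norm_square[symmetric] cmz e(1) by simp
  define u where "u = z k * cnj (z i) / of_int (e * q ^ (g * i + g * k))"
  have den: "of_int (e * q ^ (g * i + g * k)) \<noteq> (0::complex)" using e q_pos by simp
  have "u \<in> cong_units M"
  proof -
    have "(cmod u)\<^sup>2 = (cmod (z k))\<^sup>2 * (cmod (z i))\<^sup>2 / (of_int (e * q ^ (g * i + g * k)))\<^sup>2"
      using q_pos by (simp add: u_def norm_divide norm_mult norm_power power_mult_distrib power_divide)
    also have "\<dots> = 1" using e q_pos unfolding cmz
      by (simp add: power_mult_distrib power_add power2_eq_square mult_2)
    finally have "cmod u = 1 \<or> cmod u = - 1" by (simp only: power2_eq_1_iff)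
    then have "cmod u = 1" using norm_ge_zero[of u] by linarith
    have qw: "(of_int q :: complex) ^ (g * k) = of_int q ^ (g * i) + of_int M * of_int w"
      using arg_cong[OF w, of "of_int :: int \<Rightarrow> complex"] by simp
    have q2: "of_int q ^ (2 * (g * i)) = of_int q ^ (g * i) * (of_int q ^ (g * i) :: complex)"
      by (simp only: mult_2 power_add)
    have "of_int e * (of_int q ^ (g * i + g * k) * (u - 1))
        = z k * cnj (z i) - of_int e * of_int q ^ (g * i + g * k)"
      using den by (simp add: u_def right_diff_distrib)
    also have "\<dots> = z i * cnj (z i) + of_int e * of_int M * pt p p' * cnj (z i)
        - of_int e * of_int q ^ (g * i) * of_int q ^ (g * k)"
      by (simp add: zk power_add algebra_simps)
    also have "\<dots> = of_int e * (of_int M * (pt p p' * cnj (z i) - of_int q ^ (g * i) * of_int w))"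
      unfolding zz q2 qw by (simp add: power_add algebra_simps)
    finally have "of_int q ^ (g * i + g * k) * (u - 1) = of_int M * (pt p p' * cnj (z i) - of_int q ^ (g * i) * of_int w)"
      using e by simp
    moreover have "pt p p' * cnj (z i) - of_int q ^ (g * i) * of_int w \<in> \<O>"
      by (intro O_diff O_mult O_cnj) (auto simp: z_def)
    ultimately have "of_int q ^ (g * i + g * k) * (u - 1) \<in> mlat M" using M_mult_O by metis
    then show ?thesis using \<open>cmod u = 1\<close> by (auto simp: cong_units_def)
  qed
  moreover have "u \<noteq> 1"
  proof
    assume "u = 1"
    then have "z k * cnj (z i) = of_int (e * q ^ (g * i + g * k))" using den by (simp add: u_def)
    then have "z k * (z i * cnj (z i)) = of_int (e * q ^ (g * i + g * k)) * z i"
      by (simp add: mult.left_commute mult.commute)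
    then have zd: "z k * (of_int e * of_int q ^ (2 * (g * i))) = of_int (e * q ^ (g * i + g * k)) * z i"
      by (simp only: zz)
    define d where "d = g * k - g * i"
    have gk: "g * k = g * i + d" using ik(1) by (simp add: d_def)
    have "of_int (e * q ^ (g * i + g * k)) = of_int q ^ d * (of_int e * of_int q ^ (2 * (g * i)) :: complex)"
      by (simp only: gk of_int_mult of_int_power power_add mult_2) (simp only: mult_ac)
    with zd have "z k * (of_int e * of_int q ^ (2 * (g * i))) = of_int q ^ d * z i * (of_int e * of_int q ^ (2 * (g * i)))"
      by (simp only: mult_ac)
    moreover have "of_int e * of_int q ^ (2 * (g * i)) \<noteq> (0 :: complex)" using e by simp
    ultimately have "z k = of_int q ^ d * z i" by (metis mult_right_cancel)
    then have "pt (x k) (y k) = pt (q ^ d * x i) (q ^ d * y i)"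
      by (simp only: z_def flip: pt_scale of_int_power)
    then have xy: "x k = q ^ d * x i" "y k = q ^ d * y i" by (auto simp: pt_eq_iff)
    define n where "n = 2 * (g * i) + d"
    have nk: "2 * (g * k) = n + d" by (simp add: n_def gk)
    have "q ^ d * q ^ n dvd q ^ d * (x i - s k * y i)"
      using *(2)[of k] unfolding nk xy by (simp add: power_add algebra_simps)
    then have 1: "q ^ n dvd x i - s k * y i" by simp
    have 2: "q ^ n dvd (s k)\<^sup>2 + D" using *(1)[of k] unfolding nk power_add by (rule dvd_mult_left)
    have "(x i)\<^sup>2 + D * (y i)\<^sup>2 = (x i - s k * y i) * (x i + s k * y i) + (y i)\<^sup>2 * ((s k)\<^sup>2 + D)"
      by (simp add: power2_eq_square algebra_simps)
    then have "q ^ n dvd (x i)\<^sup>2 + D * (y i)\<^sup>2" using 1 2 by auto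
    then have "q ^ (2 * (g * i)) * q ^ d dvd q ^ (2 * (g * i)) * e"
      unfolding *(3) e(1) n_def power_add by (simp add: mult.commute)
    then have "q ^ d dvd e" by simp
    then have "q ^ d \<le> e" using e(3) zdvd_imp_le by blast
    moreover have "g \<le> d" using mult_le_mono2[of 1 "k - i" g] ik(1) by (simp add: d_def diff_mult_distrib2)
    then have "q ^ g \<le> q ^ d" using q_pos by (intro power_increasing) auto
    ultimately show False using e(4) qg by linarith
  qed
  ultimately show ?thesis using that by blast
qed

text \<open>Let \<open>w = q\<^sup>n u\<close> be primitive. Modulo \<open>q\<close> its norm vanishes, so \<open>w\<^sup>2\<close> is the trace \<open>2 x\<close> times \<open>w\<close>, and
\<open>w\<^sup>k\<close> is congruent to \<open>(2 x)\<^sup>k\<^sup>-\<^sup>1 w\<close>, which is nonzero; but \<open>u\<^sup>k = 1\<close> would make \<open>w\<^sup>k\<close> a power of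
\<open>q\<close>.\<close>

lemma cong_units_torsion_free:
  assumes "admissible M" "u \<in> cong_units M" "u \<noteq> 1" "k > 0"
  shows "u ^ k \<noteq> 1"
proof
  assume 1: "u ^ k = 1"
  obtain n x y where n: "n > 0" "of_int q ^ n * u = pt x y" "\<not> (q dvd x \<and> q dvd y)"
    "x\<^sup>2 + D * y\<^sup>2 = q ^ (2 * n)"
    using primitive_multiple assms(1-3) by metis
  have qx: "\<not> q dvd x"
  proof
    assume x: "q dvd x"
    have "q dvd q ^ (2 * n)" using n(1) by (intro dvd_power) auto
    then have "q dvd q ^ (2 * n) - x\<^sup>2" using x by (auto simp: power2_eq_square)
    then have "q dvd D * y\<^sup>2" using n(4) by (metis add_diff_cancel_left')
    then show False using x n(3) q_prime q_D prime_dvd_power prime_dvd_mult_iff by blast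
  qed
  define w where "w = pt x y"
  have ww: "w * w = of_int (2 * x) * w - of_int (q ^ (2 * n))"
    unfolding w_def pt_mult n(4)[symmetric] by (simp add: pt_def power2_eq_square algebra_simps)
  have pw: "\<exists>v\<in>\<O>. w ^ Suc l = of_int ((2 * x) ^ l) * w + of_int q * v" for l
  proof (induction l)
    case 0
    show ?case using of_int_in_O[of 0] by (intro bexI[of _ 0]) auto
  next
    case (Suc l)
    then obtain v where v: "v \<in> \<O>" "w ^ Suc l = of_int ((2 * x) ^ l) * w + of_int q * v" by blast
    obtain n' where n': "2 * n = Suc n'" using n(1) by (cases "2 * n") auto
    have "w ^ Suc (Suc l) = w ^ Suc l * w" by simp
    also have "\<dots> = of_int ((2 * x) ^ l) * (w * w) + of_int q * (v * w)"
      by (subst v(2)) (simp add: algebra_simps)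
    also have "\<dots> = of_int ((2 * x) ^ Suc l) * w + of_int q * (v * w - of_int ((2 * x) ^ l * q ^ n'))"
      unfolding ww n' by (simp add: algebra_simps)
    finally show ?case
      using v(1) by (rule bexI[OF _ O_diff[OF O_mult of_int_in_O]]) (simp add: w_def)
  qed
  obtain l where l: "k = Suc l" using assms(4) gr0_implies_Suc by blast
  obtain v where v: "v \<in> \<O>" "w ^ k = of_int ((2 * x) ^ l) * w + of_int q * v" using pw l by blast
  obtain v1 v2 where v12: "v = pt v1 v2" using v(1) by (rule O_cases)
  have "w ^ k = of_int q ^ (n * k)"
    unfolding w_def n(2)[symmetric] by (simp add: power_mult_distrib 1 power_mult)
  moreover have "w ^ k = pt ((2 * x) ^ l * x + q * v1) ((2 * x) ^ l * y + q * v2)"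
    by (subst v(2)) (simp only: v12 w_def pt_scale pt_add)
  ultimately have "pt (q ^ (n * k)) 0 = pt ((2 * x) ^ l * x + q * v1) ((2 * x) ^ l * y + q * v2)"
    by (simp only: pt_0 of_int_power)
  then have "q ^ (n * k) = (2 * x) ^ l * x + q * v1" by (simp add: pt_eq_iff)
  moreover have "q dvd q ^ (n * k)" using n(1) assms(4) by (intro dvd_power) auto
  ultimately have "q dvd (2 * x) ^ l * x" by (metis dvd_add_left_iff dvd_triv_left)
  then show False using qx q_prime q_odd prime_dvd_power prime_dvd_mult_iff by blast
qed

lemma powi_inj:
  assumes "admissible M" "u \<in> cong_units M" "u \<noteq> 1" "u powi i = u powi j"
  shows "i = j"
proof -
  have u0: "u \<noteq> 0" using cong_units_norm[OF assms(2)] by auto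
  have no: "i' \<ge> j'" if "u powi i' = u powi j'" for i' j'
  proof (rule ccontr)
    assume "\<not> i' \<ge> j'"
    have "u powi (j' - i') = 1" using that u0 by (simp add: power_int_diff)
    then have "u ^ nat (j' - i') = 1" using \<open>\<not> i' \<ge> j'\<close> by (simp add: power_int_def)
    then show False using cong_units_torsion_free[OF assms(1-3)] \<open>\<not> i' \<ge> j'\<close> by simp
  qed
  show ?thesis using no[of i j] no[of j i] assms(4) by simp
qed

text \<open>Choose \<open>\<theta> \<noteq> 1\<close> with the smallest denominator exponent \<open>h\<close>. Given \<open>u \<noteq> 1\<close> with denominator exponent
\<open>l \<ge> h\<close>, either \<open>u \<theta>\<close> or \<open>u / \<theta>\<close> has denominator exponent at most \<open>l - h\<close>, so induction
on the exponent expresses \<open>u\<close> as a power of \<open>\<theta>\<close> and bounds the number of factors.\<close>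

lemma cong_units_generator:
  assumes M: "admissible M"
  obtains \<theta> h where "\<theta> \<in> cong_units M" "\<theta> \<noteq> 1" "0 < h" "of_int q ^ h * \<theta> \<in> \<O>"
    "\<And>u m. u \<in> cong_units M \<Longrightarrow> of_int q ^ m * u \<in> \<O> \<Longrightarrow> \<exists>i. u = \<theta> powi i \<and> \<bar>i\<bar> * int h \<le> int m"
proof -
  define P where "P = (\<lambda>m. \<exists>u\<in>cong_units M. u \<noteq> 1 \<and> of_int q ^ m * u \<in> \<O>)"
  define h where "h = (LEAST m. P m)"
  obtain u0 where "u0 \<in> cong_units M" "u0 \<noteq> 1" using cong_units_nontrivial M by blast
  moreover obtain m0 where "of_int q ^ m0 * u0 \<in> \<O>" using cong_units_integral M \<open>u0 \<in> cong_units M\<close> by blast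
  ultimately have "P m0" by (auto simp: P_def)
  then have "P h" unfolding h_def by (rule LeastI)
  then obtain \<theta> where \<theta>: "\<theta> \<in> cong_units M" "\<theta> \<noteq> 1" "of_int q ^ h * \<theta> \<in> \<O>" by (auto simp: P_def)
  have least: "h \<le> m" if "u \<in> cong_units M" "u \<noteq> 1" "of_int q ^ m * u \<in> \<O>" for u m
    unfolding h_def using that by (intro Least_le) (auto simp: P_def)
  have t0: "\<theta> \<noteq> 0" using cong_units_norm[OF \<theta>(1)] by auto
  obtain n c d where cd: "n > 0" "of_int q ^ n * \<theta> = pt c d" "\<not> (q dvd c \<and> q dvd d)"
    "c\<^sup>2 + D * d\<^sup>2 = q ^ (2 * n)" "\<And>m. of_int q ^ m * \<theta> \<in> \<O> \<Longrightarrow> n \<le> m"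
    using primitive_multiple[OF M \<theta>(1,2)] by metis
  have "h \<le> n" using least[OF \<theta>(1,2)] cd(2) by simp
  moreover have "n \<le> h" using cd(5) \<theta>(3) .
  ultimately have nh: "n = h" by simp
  note cd = cd[unfolded nh]
  have "\<exists>i. u = \<theta> powi i \<and> \<bar>i\<bar> * int h \<le> int m" if "u \<in> cong_units M" "of_int q ^ m * u \<in> \<O>" for u m
    using that
  proof (induction m arbitrary: u rule: less_induct)
    case (less m)
    show ?case
    proof (cases "u = 1")
      case True
      then show ?thesis by (intro exI[of _ 0]) auto
    next
      case False
      obtain l x y where xy: "l > 0" "of_int q ^ l * u = pt x y" "\<not> (q dvd x \<and> q dvd y)"
        "x\<^sup>2 + D * y\<^sup>2 = q ^ (2 * l)" "\<And>m. of_int q ^ m * u \<in> \<O> \<Longrightarrow> l \<le> m"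
        using primitive_multiple[OF M less.prems(1) False] by metis
      have lm: "l \<le> m" using xy(5) less.prems(2) .
      have hl: "h \<le> l" using least[OF less.prems(1) False] xy(2) by simp
      \<comment> \<open>To be used with \<open>v = \<theta>\<close> and with \<open>v = cnj \<theta>\<close>.\<close>
      have step: "\<exists>i. u * v = \<theta> powi i \<and> \<bar>i\<bar> * int h \<le> int (l - h)"
        if v: "v \<in> cong_units M" "of_int q ^ h * v = pt v1 v2"
          and dv: "q ^ (2 * h) dvd x * v1 - D * y * v2" "q ^ (2 * h) dvd y * v1 + x * v2" for v v1 v2
      proof -
        obtain r s where rs: "x * v1 - D * y * v2 = q ^ (2 * h) * r" "y * v1 + x * v2 = q ^ (2 * h) * s"
          using dv by (auto elim!: dvdE)
        have "of_int q ^ (2 * h) * (of_int q ^ (l - h) * (u * v)) = (of_int q ^ l * u) * (of_int q ^ h * v)"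
          using hl by (simp add: algebra_simps flip: power_add)
        also have "\<dots> = of_int (q ^ (2 * h)) * pt r s" unfolding xy(2) v(2) pt_mult rs pt_scale ..
        finally have "of_int q ^ (l - h) * (u * v) = pt r s" by simp
        then show ?thesis using less.IH[of "l - h" "u * v"] lm hl cd(1) cong_units_mult[OF M less.prems(1) v(1)] by simp
      qed
      have cd': "of_int q ^ h * cnj \<theta> = pt c (- d)" using arg_cong[OF cd(2), of cnj] by (simp add: pt_cnj)
      have inv: "\<theta> * cnj \<theta> = 1" using cnj_unit cong_units_norm \<theta>(1) by blast
      consider "q ^ (2 * h) dvd x * c - D * y * d" "q ^ (2 * h) dvd y * c + x * d"
        | "q ^ (2 * h) dvd x * c + D * y * d" "q ^ (2 * h) dvd y * c - x * d"
        using primitive_prime_power_norms_divide[OF q_prime q_odd q_D cd(1) hl xy(4,3) cd(4,3)] by blast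
      then show ?thesis
      proof cases
        case 1
        then obtain i where i: "u * \<theta> = \<theta> powi i" "\<bar>i\<bar> * int h \<le> int (l - h)"
          using step[OF \<theta>(1) cd(2)] by blast
        have "u = \<theta> powi (i - 1)" using i(1) t0 by (simp add: power_int_diff field_simps)
        moreover have "\<bar>i - 1\<bar> * int h \<le> (\<bar>i\<bar> + 1) * int h" by (intro mult_right_mono) auto
        then have "\<bar>i - 1\<bar> * int h \<le> int m" using i(2) hl lm by (simp add: algebra_simps of_nat_diff)
        ultimately show ?thesis by blast
      next
        case 2
        then obtain i where i: "u * cnj \<theta> = \<theta> powi i" "\<bar>i\<bar> * int h \<le> int (l - h)"
          using step[OF cong_units_cnj[OF M \<theta>(1)] cd'] by auto
        have "u = u * cnj \<theta> * \<theta>" using inv by (simp add: mult.assoc mult.commute)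
        also have "\<dots> = \<theta> powi (i + 1)" unfolding i(1) using t0 by (simp add: power_int_add)
        finally have "u = \<theta> powi (i + 1)" .
        moreover have "\<bar>i + 1\<bar> * int h \<le> (\<bar>i\<bar> + 1) * int h" by (intro mult_right_mono) auto
        then have "\<bar>i + 1\<bar> * int h \<le> int m" using i(2) hl lm by (simp add: algebra_simps of_nat_diff)
        ultimately show ?thesis by blast
      qed
    qed
  qed
  then show ?thesis using that \<theta> cd(1) by blast
qed

text \<open>The converse of the bound in \<open>cong_units_generator\<close>: each factor \<open>u\<close>, or its conjugate for negative exponents,
needs one factor \<open>q\<^sup>h\<close>.\<close>

lemma powi_integral:
  assumes "admissible M" "u \<in> cong_units M" "of_int q ^ h * u \<in> \<O>" "\<bar>i\<bar> * int h \<le> int m"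
  shows "of_int q ^ m * u powi i \<in> \<O>"
proof -
  have *: "of_int q ^ m * v ^ n \<in> \<O>" if "of_int q ^ h * v \<in> \<O>" "n * h \<le> m" for v n
  proof -
    have "of_int q ^ m * v ^ n = of_int q ^ (m - n * h) * (of_int q ^ h * v) ^ n"
      using that(2) by (simp add: power_mult_distrib mult.assoc[symmetric] mult.commute[of n]
          flip: power_mult power_add)
    then show ?thesis using that by (simp add: O_mult O_power)
  qed
  have "of_int q ^ h * cnj u \<in> \<O>" using O_cnj[OF assms(3)] by simp
  moreover have "nat \<bar>i\<bar> * h \<le> m"
  proof -
    have "int (nat \<bar>i\<bar> * h) \<le> int m" using assms(4) by simp
    then show ?thesis by linarith
  qed
  ultimately show ?thesis using * assms(3) by (auto simp: power_int_def inverse_cong_units[OF assms(2)])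
qed

text \<open>A fixed nonzero difference \<open>u - 1\<close> cannot be divisible by a modulus exceeding its coordinates. The
number \<open>N\<close> has the form \<open>q \<cdot> \<dots> + 1\<close> to keep it coprime to \<open>q\<close>.\<close>

lemma cong_units_eventually_excludes:
  assumes M: "admissible M" and u: "u \<in> cong_units M" "u \<noteq> 1"
  obtains M' where "admissible M'" "M dvd M'" "u \<notin> cong_units M'"
proof -
  obtain n where n: "of_int q ^ n * (u - 1) \<in> mlat M" using cong_units_integral M u by blast
  then obtain x y where xy: "of_int q ^ n * (u - 1) = pt x y"
    using mlat_subset_O[OF M] by (metis O_cases)
  have ne: "x \<noteq> 0 \<or> y \<noteq> 0" using xy u(2) pt_eq_0[of 0 0] by auto
  define N where "N = q * (\<bar>x\<bar> + \<bar>y\<bar>) + 1"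
  have N: "N > \<bar>x\<bar>" "N > \<bar>y\<bar>"
  proof -
    have "1 * (\<bar>x\<bar> + \<bar>y\<bar>) \<le> q * (\<bar>x\<bar> + \<bar>y\<bar>)" using q_pos by (intro mult_right_mono) auto
    then show "N > \<bar>x\<bar>" "N > \<bar>y\<bar>" by (auto simp: N_def)
  qed
  have cop: "coprime N q"
  proof (rule coprimeI)
    fix d assume "d dvd N" "d dvd q"
    then have "d dvd N - q * (\<bar>x\<bar> + \<bar>y\<bar>)" by (intro dvd_diff) auto
    then show "d dvd 1" by (simp add: N_def)
  qed
  have "admissible (M * N)" using M cop N by (auto simp: admissible_def)
  moreover have "u \<notin> cong_units (M * N)"
  proof
    assume "u \<in> cong_units (M * N)"
    then obtain m where "of_int q ^ m * (u - 1) \<in> mlat (M * N)" by (auto simp: cong_units_def)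
    then have "of_int q ^ n * (of_int q ^ m * (u - 1)) \<in> mlat (M * N)" by (simp add: O_mult_mlat)
    then have "of_int (q ^ m) * pt x y \<in> mlat (M * N)" by (simp add: mult.left_commute flip: xy)
    moreover have "N * a dvd M * N" using M by (auto simp: admissible_def mult.commute intro: mult_dvd_mono dvd_mult_right)
    ultimately obtain x' y' where "pt (q ^ m * x) (q ^ m * y) = pt (N * x') (N * y')"
      using mlat_dvd unfolding pt_scale by metis
    then have "N dvd q ^ m * x" "N dvd q ^ m * y" by (simp_all add: pt_eq_iff)
    moreover have "coprime N (q ^ m)" using cop by simp
    ultimately have "N dvd x" "N dvd y" by (auto simp: coprime_dvd_mult_right_iff)
    then have "x = 0" "y = 0" using N zdvd_imp_le[of N "\<bar>x\<bar>"] zdvd_imp_le[of N "\<bar>y\<bar>"] by fastforce+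
    then show False using ne by simp
  qed
  ultimately show ?thesis using that by simp
qed

lemma admissible_3a: "admissible (3 * a)"
  unfolding admissible_def using a_pos prime_imp_coprime[OF q_prime q_a]
  by (metis coprime_commute dvd_refl mult_pos_pos zero_less_numeral)

text \<open>Enlarging the modulus so as to exclude the generator leaves a nontrivial proper subgroup of an
infinite cyclic group. Properness, that is \<open>2 \<le> t\<close>, is what makes even numbers of points possible:
the coset of \<open>\<theta>\<close> then differs from the subgroup.\<close>

lemma cong_units_subgroup_of_cyclic:
  obtains \<theta> h M t where "admissible M" "\<theta> \<in> cong_units (3 * a)" "\<theta> \<noteq> 1" "0 < h" "of_int q ^ h * \<theta> \<in> \<O>"
    "\<And>u m. u \<in> cong_units (3 * a) \<Longrightarrow> of_int q ^ m * u \<in> \<O> \<Longrightarrow> \<exists>i. u = \<theta> powi i \<and> \<bar>i\<bar> * int h \<le> int m"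
    "2 \<le> t" "\<And>u. u \<in> cong_units M \<longleftrightarrow> (\<exists>i. u = \<theta> powi (t * i))"
proof -
  note L1 = admissible_3a
  obtain \<theta> h where \<theta>: "\<theta> \<in> cong_units (3 * a)" "\<theta> \<noteq> 1" "0 < h" "of_int q ^ h * \<theta> \<in> \<O>"
    and gen: "\<And>u m. u \<in> cong_units (3 * a) \<Longrightarrow> of_int q ^ m * u \<in> \<O> \<Longrightarrow> \<exists>i. u = \<theta> powi i \<and> \<bar>i\<bar> * int h \<le> int m"
    using cong_units_generator[OF L1] by metis
  obtain M where M: "admissible M" "3 * a dvd M" "\<theta> \<notin> cong_units M" using cong_units_eventually_excludes[OF L1 \<theta>(1,2)] by blast
  obtain \<eta> where \<eta>: "\<eta> \<in> cong_units M" "\<eta> \<noteq> 1"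
    and gen': "\<And>u m. u \<in> cong_units M \<Longrightarrow> of_int q ^ m * u \<in> \<O> \<Longrightarrow> \<exists>i. u = \<eta> powi i"
    using cong_units_generator[OF M(1)] by metis
  have "\<eta> \<in> cong_units (3 * a)" using cong_units_mono M(2) \<eta>(1) by blast
  then obtain t where t: "\<eta> = \<theta> powi t" using gen cong_units_integral[OF L1] by metis
  have V1: "\<theta> powi (t * i) \<in> cong_units M" for i
    using cong_units_powi[OF M(1) \<eta>(1), of i] by (simp add: t power_int_mult)
  have V2: "\<exists>i. u = \<theta> powi (t * i)" if "u \<in> cong_units M" for u
    using gen'[OF that] cong_units_integral[OF M(1) that] by (metis t power_int_mult)
  have "t \<noteq> 0" using t \<eta>(2) by auto
  moreover have "t \<noteq> 1" "t \<noteq> -1" using V1[of 1] V1[of "-1"] M(3) by auto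
  ultimately have "2 \<le> \<bar>t\<bar>" by linarith
  moreover have "u \<in> cong_units M \<longleftrightarrow> (\<exists>i. u = \<theta> powi (\<bar>t\<bar> * i))" for u
  proof
    assume "u \<in> cong_units M"
    then obtain i where "u = \<theta> powi (t * i)" using V2 by blast
    then have "u = \<theta> powi (\<bar>t\<bar> * (sgn t * i))" by (simp add: mult.assoc[symmetric] abs_mult_sgn)
    then show "\<exists>i. u = \<theta> powi (\<bar>t\<bar> * i)" by blast
  next
    assume "\<exists>i. u = \<theta> powi (\<bar>t\<bar> * i)"
    then obtain i where "u = \<theta> powi (t * (sgn t * i))"
      by (metis mult.assoc abs_sgn)
    then show "u \<in> cong_units M" using V1 by simp
  qed
  ultimately show ?thesis using that[OF M(1) \<theta> gen] by blast
qed

section \<open>Circles with a prescribed number of points\<close>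

text \<open>On the circle of radius \<open>q\<^sup>m\<close> the coset of \<open>q\<^sup>m \<theta>\<^sup>c\<close> consists of the points \<open>q\<^sup>m \<theta>\<^sup>c\<^sup>+\<^sup>t\<^sup>i\<close>
that are integral, which is a condition on \<open>\<bar>c + t i\<bar>\<close> alone. Thus the points are counted by an
interval of integers \<open>i\<close>.\<close>

lemma coset_circle_counts:
  assumes "n > 0"
  obtains M z0 r where "M > 0" "r > 0" "card {z. z - z0 \<in> mlat M \<and> cmod z = r} = n"
proof -
  obtain \<theta> h M t where M: "admissible M" and \<theta>: "\<theta> \<in> cong_units (3 * a)" "\<theta> \<noteq> 1" "0 < h" "of_int q ^ h * \<theta> \<in> \<O>"
    and gen: "\<And>u m. u \<in> cong_units (3 * a) \<Longrightarrow> of_int q ^ m * u \<in> \<O> \<Longrightarrow> \<exists>i. u = \<theta> powi i \<and> \<bar>i\<bar> * int h \<le> int m"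
    and t: "2 \<le> t" and VM: "\<And>u. u \<in> cong_units M \<longleftrightarrow> (\<exists>i. u = \<theta> powi (t * i))"
    by (rule cong_units_subgroup_of_cyclic) (rule that; assumption)
  note L1 = admissible_3a
  have t0: "\<theta> \<noteq> 0" using cong_units_norm[OF \<theta>(1)] by auto
  note int_pow = powi_integral[OF L1 \<theta>(1,4)]
  have main: "card {z. z - of_int q ^ m * \<theta> powi c \<in> mlat M \<and> cmod z = of_int q ^ m}
      = card {i. \<bar>c + t * i\<bar> * int h \<le> int m}" (is "card ?S = card ?I")
    if cm: "\<bar>c\<bar> * int h \<le> int m" for c m
  proof -
    have inj: "inj_on (\<lambda>i. of_int q ^ m * \<theta> powi (c + t * i)) ?I"
      using t by (intro inj_onI) (auto dest!: powi_inj[OF L1 \<theta>(1,2)])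
    have O0: "of_int q ^ m * \<theta> powi c \<in> \<O>" using int_pow cm by blast
    have "?S = (\<lambda>i. of_int q ^ m * \<theta> powi (c + t * i)) ` ?I"
    proof (intro equalityI subsetI)
      fix z assume "z \<in> ?S"
      then have z: "z - of_int q ^ m * \<theta> powi c \<in> mlat M" "cmod z = of_int q ^ m" by auto
      define u where "u = z / of_int q ^ m"
      have zu: "z = of_int q ^ m * u" by (simp add: u_def)
      have u1: "cmod u = 1" using z(2) q_pos by (simp add: u_def norm_divide norm_power)
      have "z = (z - of_int q ^ m * \<theta> powi c) + of_int q ^ m * \<theta> powi c" by simp
      then have zO: "z \<in> \<O>" using O_add[OF mlat_subset_O[OF M z(1)] O0] by simp
      have "\<theta> powi (- c) \<in> cong_units (3 * a)" using cong_units_powi L1 \<theta>(1) by blast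
      then obtain k where k: "of_int q ^ k * \<theta> powi (- c) \<in> \<O>" using cong_units_integral[OF L1] by metis
      have "of_int q ^ (k + m) * (u * \<theta> powi (- c) - 1)
          = of_int q ^ k * \<theta> powi (- c) * (z - of_int q ^ m * \<theta> powi c)"
        using t0 by (simp add: zu power_add power_int_minus field_simps)
      then have "of_int q ^ (k + m) * (u * \<theta> powi (- c) - 1) \<in> mlat M"
        using k z(1) O_mult_mlat by metis
      moreover have "cmod (u * \<theta> powi (- c)) = 1"
        using u1 cong_units_norm[OF \<theta>(1)] by (simp add: norm_mult norm_power_int)
      ultimately have "u * \<theta> powi (- c) \<in> cong_units M" by (auto simp: cong_units_def)
      then obtain i where "u * \<theta> powi (- c) = \<theta> powi (t * i)" using VM by blast
      then have ui: "u = \<theta> powi (c + t * i)" using t0 by (simp add: power_int_add power_int_minus field_simps)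
      then have "u \<in> cong_units (3 * a)" using cong_units_powi L1 \<theta>(1) by blast
      then obtain j where "u = \<theta> powi j" "\<bar>j\<bar> * int h \<le> int m" using gen zO zu by blast
      then have "i \<in> ?I" using ui powi_inj[OF L1 \<theta>(1,2)] by auto
      then show "z \<in> (\<lambda>i. of_int q ^ m * \<theta> powi (c + t * i)) ` ?I" using zu ui by blast
    next
      fix z assume "z \<in> (\<lambda>i. of_int q ^ m * \<theta> powi (c + t * i)) ` ?I"
      then obtain i where i: "\<bar>c + t * i\<bar> * int h \<le> int m" "z = of_int q ^ m * \<theta> powi (c + t * i)" by blast
      have "\<theta> powi (t * i) \<in> cong_units M" using VM by blast
      then obtain k where k: "of_int q ^ k * (\<theta> powi (t * i) - 1) \<in> mlat M" using cong_units_integral[OF M] by metis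
      have "of_int q ^ k * (z - of_int q ^ m * \<theta> powi c)
          = of_int q ^ m * \<theta> powi c * (of_int q ^ k * (\<theta> powi (t * i) - 1))"
        using t0 by (simp add: i(2) power_int_add algebra_simps)
      then have "of_int q ^ k * (z - of_int q ^ m * \<theta> powi c) \<in> mlat M" using O_mult_mlat O0 k by metis
      moreover have "z \<in> \<O>" using int_pow i by blast
      ultimately have "z - of_int q ^ m * \<theta> powi c \<in> mlat M" using mlat_cancel_q M O_diff O0 by blast
      moreover have "cmod z = of_int q ^ m"
        using cong_units_norm[OF \<theta>(1)] q_pos by (simp add: i(2) norm_mult norm_power norm_power_int)
      ultimately show "z \<in> ?S" by simp
    qed
    then show ?thesis using card_image[OF inj] by simp
  qed
  have M0: "M > 0" using M by (simp add: admissible_def)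
  have r0: "(of_int q :: real) ^ m > 0" for m using q_pos by simp
  show ?thesis
  proof (cases "odd n")
    case True
    then obtain k where k: "n = 2 * k + 1" by (elim oddE)
    \<comment> \<open>Exactly \<open>- k \<le> i \<le> k\<close> satisfy \<open>\<bar>t i\<bar> h \<le> m\<close>.\<close>
    define m where "m = nat t * k * h"
    have m: "int m = t * int k * int h" using t by (simp add: m_def)
    have "{i. \<bar>0 + t * i\<bar> * int h \<le> int m} = {- int k..int k}"
      using t \<theta>(3) unfolding m by (auto simp: abs_mult)
    then have "card {z. z - of_int q ^ m * \<theta> powi 0 \<in> mlat M \<and> cmod z = of_int q ^ m} = n"
      using main[of 0 m] by (simp add: k)
    then show ?thesis using that M0 r0 by blast
  next
    case False
    then obtain k where k: "n = 2 * k" by (auto elim: evenE)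
    \<comment> \<open>The bound \<open>t k - 1\<close> is the value of \<open>\<bar>1 + t i\<bar>\<close> at \<open>i = - k\<close>; it admits \<open>i = k - 1\<close> because \<open>t \<ge> 2\<close>, but not \<open>i = k\<close>.\<close>
    define m where "m = (nat t * k - 1) * h"
    have tk: "2 * 1 \<le> t * int k" using t k assms by (intro mult_mono) auto
    then have "1 \<le> nat t * k"
      using t k assms by (simp add: Suc_le_eq)
    then have m: "int m = (t * int k - 1) * int h" using t by (simp add: m_def of_nat_diff)
    have "\<bar>1 + t * i\<bar> * int h \<le> int m \<longleftrightarrow> i \<in> {- int k..int k - 1}" for i
    proof -
      have "\<bar>1 + t * i\<bar> * int h \<le> int m \<longleftrightarrow> \<bar>1 + t * i\<bar> \<le> t * int k - 1"
        unfolding m using \<theta>(3) by simp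
      also have "\<dots> \<longleftrightarrow> 2 \<le> t * (int k - i) \<and> 0 \<le> t * (int k + i)"
        by (auto simp: algebra_simps abs_le_iff)
      also have "2 \<le> t * (int k - i) \<longleftrightarrow> 1 \<le> int k - i"
      proof
        assume "2 \<le> t * (int k - i)"
        then show "1 \<le> int k - i" using t by (smt (verit) mult_nonneg_nonpos)
      next
        assume "1 \<le> int k - i"
        then have "2 * 1 \<le> t * (int k - i)" using t by (intro mult_mono) auto
        then show "2 \<le> t * (int k - i)" by simp
      qed
      also have "0 \<le> t * (int k + i) \<longleftrightarrow> 0 \<le> int k + i" using t by (simp add: zero_le_mult_iff)
      finally show ?thesis by auto
    qed
    then have I: "{i. \<bar>1 + t * i\<bar> * int h \<le> int m} = {- int k..int k - 1}" by blast
    have "\<bar>1\<bar> * int h \<le> int m" unfolding m using tk by (intro mult_right_mono) auto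
    from main[OF this] have "card {z. z - of_int q ^ m * \<theta> powi 1 \<in> mlat M \<and> cmod z = of_int q ^ m} = n"
      unfolding I by (simp add: k)
    then show ?thesis using that M0 r0 by blast
  qed
qed

end

context quad_lattice
begin

text \<open>A prime divisor \<open>q\<close> of \<open>36 a\<^sup>2 D + 1\<close> is coprime to \<open>6 a D\<close>, and \<open>(6 a D)\<^sup>2 + D = D (36 a\<^sup>2 D + 1)\<close>
exhibits \<open>- D\<close> as a square modulo \<open>q\<close>. The coset \<open>z\<^sub>0 + M \<Lambda>\<close> around \<open>0\<close> is, up to scaling, the
lattice itself around the centre \<open>- z\<^sub>0 / M\<close>.\<close>

lemma lattice_circle_counts:
  assumes "n > 0"
  obtains c r where "r > 0" "card {w \<in> lat. cmod (w - c) = r} = n"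
proof -
  define e where "e = (6 * a)\<^sup>2 * D + 1"
  have e: "e > 1" using a_pos D_pos by (simp add: e_def)
  then obtain q where q: "prime q" "q dvd e"
    by (metis prime_factor_int abs_of_pos less_irrefl order.strict_trans zero_less_one)
  have nd: "\<not> q dvd 6 * a * D"
  proof
    assume "q dvd 6 * a * D"
    then have "q dvd e - 6 * a * (6 * a * D)" using q(2) dvd_diff dvd_mult by metis
    then have "q dvd 1" by (simp add: e_def power2_eq_square algebra_simps)
    then show False using q(1) by (meson not_prime_unit)
  qed
  have "q dvd D * e" using q(2) by simp
  then have split: "q dvd (6 * a * D)\<^sup>2 + D" by (simp add: e_def power2_eq_square algebra_simps)
  have six: "6 * a * D = 2 * (3 * a * D)" "6 * a * D = 3 * a * (2 * D)" by auto
  have "quad_lattice_prime D a b \<omega> \<tau> q"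
  proof unfold_locales
    show "\<not> q dvd 2" using nd unfolding six(1) by (meson dvd_mult2)
    show "\<not> q dvd D" using nd by (meson dvd_mult)
    show "\<not> q dvd 3 * a" using nd unfolding six(2) by (meson dvd_mult2)
  qed (use q split in blast)+
  then interpret quad_lattice_prime D a b \<omega> \<tau> q .
  obtain M z0 r where Mr: "M > 0" "r > 0" "card {z. z - z0 \<in> mlat M \<and> cmod z = r} = n"
    using coset_circle_counts assms by blast
  have "{z. z - z0 \<in> mlat M \<and> cmod z = r} = (\<lambda>w. z0 + of_int M * w) ` {w \<in> lat. cmod (w - (- z0 / of_int M)) = r / of_int M}"
    (is "?S = ?f ` ?T")
  proof (intro equalityI subsetI)
    fix z assume "z \<in> ?S"
    then obtain w where w: "w \<in> lat" "z = z0 + of_int M * w" and r: "cmod z = r"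
      by (auto simp: mlat_def algebra_simps)
    have "w - (- z0 / of_int M) = z / of_int M" using Mr(1) by (simp add: w field_simps)
    then have "w \<in> ?T" using w(1) r Mr(1) by (simp add: norm_divide)
    then show "z \<in> ?f ` ?T" using w by blast
  next
    fix z assume "z \<in> ?f ` ?T"
    then obtain w where w: "w \<in> lat" "z = z0 + of_int M * w" "cmod (w - (- z0 / of_int M)) = r / of_int M" by blast
    have "w - (- z0 / of_int M) = z / of_int M" using Mr(1) by (simp add: w field_simps)
    then have "cmod z = r" using w(3) Mr(1) by (simp add: norm_divide)
    then show "z \<in> ?S" using w by (auto simp: mlat_def)
  qed
  moreover have "inj_on ?f ?T" using Mr(1) by (auto simp: inj_on_def)
  then have "card (?f ` ?T) = card ?T" by (rule card_image)
  ultimately have "card ?T = n" using Mr(3) by simp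
  moreover have "r / of_int M > 0" using Mr by simp
  ultimately show ?thesis using that by blast
qed

end

text \<open>Division by the image of \<open>u\<close> is a similarity that carries \<open>L\<close> to \<open>\<int> + \<int>\<tau>\<close>. The number \<open>\<delta>\<close> is
the signed area of the fundamental parallelogram, whose square is the Gram determinant \<open>D\<close>.\<close>

theorem theorem1p2:
  fixes L :: "(real ^ 2) set"
  assumes "integral_lattice L"
  shows "universally_concyclic L"
proof -
  obtain u v where uv: "u \<noteq> v" "independent {u, v}"
    and L: "L = {of_int a *\<^sub>R u + of_int b *\<^sub>R v | a b :: int. True}"
    and int: "\<forall>x\<in>L. \<forall>y\<in>L. x \<bullet> y \<in> \<int>"
    using assms by (auto simp: integral_lattice_def plane_lattice_def)
  have "u = of_int 1 *\<^sub>R u + of_int 0 *\<^sub>R v" "v = of_int 0 *\<^sub>R u + of_int 1 *\<^sub>R v" by auto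
  then have uvL: "u \<in> L" "v \<in> L" unfolding L by blast+
  obtain a b c where abc: "u \<bullet> u = of_int a" "u \<bullet> v = of_int b" "v \<bullet> v = of_int c"
    using int uvL Ints_cases by metis
  define D where "D = a * c - b\<^sup>2"
  define \<phi> where "\<phi> = (\<lambda>x :: real ^ 2. Complex (x $ 1) (x $ 2))"
  have ip: "x \<bullet> y = x $ 1 * y $ 1 + x $ 2 * y $ 2" for x y :: "real ^ 2"
    by (simp add: inner_vec_def sum_2)
  define \<delta> where "\<delta> = u $ 1 * v $ 2 - u $ 2 * v $ 1"
  have \<delta>: "\<delta>\<^sup>2 = of_int D"
  proof -
    have "\<delta>\<^sup>2 = (u \<bullet> u) * (v \<bullet> v) - (u \<bullet> v)\<^sup>2"
      unfolding ip \<delta>_def by (simp add: power2_eq_square algebra_simps)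
    then show ?thesis by (simp add: abc D_def)
  qed
  have u0: "u \<noteq> 0" using uv dependent_zero by auto
  have "\<delta> \<noteq> 0"
  proof
    assume d0: "\<delta> = 0"
    have "(u \<bullet> u) *\<^sub>R v = (u \<bullet> v) *\<^sub>R u"
      using d0 unfolding \<delta>_def ip
      by (simp add: vec_eq_iff forall_2) (auto simp: algebra_simps; algebra)
    then have "v = ((u \<bullet> v) / (u \<bullet> u)) *\<^sub>R u" using u0
      by (metis divide_inverse_commute inner_eq_zero_iff scaleR_scaleR scaleR_one left_inverse)
    then have "v \<in> span {u}" by (metis span_base span_scale singletonI)
    then show False using uv by (metis independent_insert insert_commute singletonD)
  qed
  then have Dp: "D > 0" using \<delta> by (metis of_int_0_less_iff zero_less_power2)
  have ap: "a > 0" using abc(1) u0 by (metis inner_gt_zero_iff of_int_0_less_iff)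
  define \<omega> where "\<omega> = Complex 0 \<delta>"
  define \<tau> where "\<tau> = \<phi> v / \<phi> u"
  have \<phi>u: "\<phi> u \<noteq> 0" using u0 by (auto simp: \<phi>_def complex_eq_iff vec_eq_iff forall_2)
  interpret quad_lattice D a b \<omega> \<tau>
  proof
    show "\<omega> * \<omega> = - of_int D" using \<delta> by (simp add: \<omega>_def complex_eq_iff power2_eq_square)
    show "cnj \<omega> = - \<omega>" by (simp add: \<omega>_def complex_eq_iff)
    have "(of_int b + \<omega>) * \<phi> u = of_int a * \<phi> v"
      unfolding complex_eq_iff using abc[unfolded ip]
      by (simp add: \<omega>_def \<phi>_def \<delta>_def flip: abc(1,2)) (simp add: ip algebra_simps)
    then show "of_int a * \<tau> = of_int b + \<omega>" using \<phi>u by (simp add: \<tau>_def field_simps)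
    show "a dvd b\<^sup>2 + D" by (simp add: D_def)
  qed (use Dp ap in auto)
  show ?thesis unfolding universally_concyclic_def
  proof (intro allI impI)
    fix n :: nat assume "n > 0"
    then obtain z r where zr: "r > 0" "card {w \<in> lat. cmod (w - z) = r} = n"
      using lattice_circle_counts by blast
    define ctr :: "real ^ 2" where "ctr = vector [Re (\<phi> u * z), Im (\<phi> u * z)]"
    define R where "R = cmod (\<phi> u) * r"
    have ctr: "\<phi> ctr = \<phi> u * z" by (simp add: \<phi>_def ctr_def complex_eq_iff)
    have \<phi>_lin: "\<phi> (x - y) = \<phi> x - \<phi> y" "\<phi> (x + y) = \<phi> x + \<phi> y" "\<phi> (s *\<^sub>R x) = of_real s * \<phi> x" for x y s
      by (simp_all add: \<phi>_def complex_eq_iff)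
    have \<phi>_norm: "cmod (\<phi> x) = norm x" for x
      by (simp add: \<phi>_def norm_eq_sqrt_inner[of x] ip cmod_def power2_eq_square)
    have \<phi>_inj: "x = y" if "\<phi> x = \<phi> y" for x y
      using that by (simp add: \<phi>_def vec_eq_iff forall_2)
    define f where "f = (\<lambda>x. \<phi> x / \<phi> u)"
    have f_comb: "f (of_int k *\<^sub>R u + of_int l *\<^sub>R v) = of_int k + of_int l * \<tau>" for k l :: int
      using \<phi>u by (simp add: f_def \<phi>_lin \<tau>_def field_simps)
    have sph: "x \<in> sphere ctr R \<longleftrightarrow> cmod (f x - z) = r" for x
    proof -
      have "norm (x - ctr) = cmod (\<phi> u) * cmod (f x - z)"
        using \<phi>u by (simp add: \<phi>_lin ctr f_def right_diff_distrib flip: \<phi>_norm norm_mult)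
      then show ?thesis using \<phi>u by (simp add: R_def dist_norm norm_minus_commute)
    qed
    have "bij_betw f (L \<inter> sphere ctr R) {w \<in> lat. cmod (w - z) = r}"
    proof (rule bij_betw_imageI)
      show "inj_on f (L \<inter> sphere ctr R)" using \<phi>u \<phi>_inj by (auto simp: f_def inj_on_def)
      have lat: "lat = f ` L" unfolding L lat_def using f_comb by (auto simp: image_iff) metis+
      have "L \<inter> sphere ctr R = {x \<in> L. cmod (f x - z) = r}" using sph by blast
      then show "f ` (L \<inter> sphere ctr R) = {w \<in> lat. cmod (w - z) = r}" unfolding lat by auto
    qed
    then have "card (L \<inter> sphere ctr R) = n" using zr(2) bij_betw_same_card by metis
    moreover have "R > 0" using zr(1) \<phi>u by (simp add: R_def)
    ultimately show "\<exists>c r. r > 0 \<and> card (L \<inter> sphere c r) = n" by blast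
  qed
qed

end
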